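(* Consider the Markov jump linear system $x_{k+1}=A_k(r_k)x_k+B_k(r_k)u_k+c_k(r_k)+G_k(r_k)w_k$, $k=0,\dots,T-1$, under the mode-dependent affine feedback policy that applies, when $r_k=i$, the control $$u_k=u_k(i)=\overline u_k(i)+K_k(i)\big(x_k-\overline x_k(i)\big),$$ with deterministic $\overline u_k(i)\in\mathbb R^{n_u}$ and $K_k(i)\in\mathbb R^{n_u\times n_x}$, and assume $\rho_k(i)>0$ for all $k\in\{0,\dots,T\}$ and $i\in\mathcal S$. Then for all $k\in\{0,\dots,T-1\}$ and $j\in\mathcal S$, $$q_{k+1}(j)=\sum_{i\in\mathcal S}p_{ij}\Big(A_k(i)q_k(i)+\rho_k(i)\big(B_k(i)\overline u_k(i)+c_k(i)\big)\Big)$$ and $$\begin{aligned}S_{k+1}(j)=\sum_{i\in\mathcal S}p_{ij}\Big\{&A_k(i)S_k(i)A_k^\top(i)+A_k(i)S_k(i)K_k^\top(i)B_k^\top(i)+B_k(i)K_k(i)S_k(i)A_k^\top(i)\\&+B_k(i)\big(\rho_k(i)\overline u_k(i)\overline u_k^\top(i)+K_k(i)S_k(i)K_k^\top(i)\big)B_k^\top(i)\\&+\rho_k(i)\Big(B_k(i)\overline u_k(i)c_k^\top(i)+B_k(i)\overline u_k(i)\overline x_k^\top(i)A_k^\top(i)+c_k(i)c_k^\top(i)+A_k(i)\overline x_k(i)\overline u_k^\top(i)B_k^\top(i)\\&\quad+c_k(i)\overline u_k^\top(i)B_k^\top(i)+c_k(i)\overline x_k^\top(i)A_k^\top(i)+G_k(i)G_k^\top(i)+A_k(i)\overline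 x_k(i)c_k^\top(i)\\&\quad+A_k(i)\overline x_k(i)\overline x_k^\top(i)A_k^\top(i)\Big)\Big\}-\rho_{k+1}(j)\overline x_{k+1}(j)\overline x_{k+1}^\top(j).\end{aligned}$$
   Context: $(r_k)_{k\ge0}$ is a time-homogeneous Markov chain on $\mathcal S=\{1,\dots,N\}$ with transition matrix $\mathcal P=(p_{ij})$ and initial distribution $\rho_0$. The state is $x_k\in\mathbb R^{n_x}$, the control is in $\mathbb R^{n_u}$, and for each $k$ and $i$ the matrices $A_k(i)\in\mathbb R^{n_x\times n_x}$, $B_k(i)\in\mathbb R^{n_x\times n_u}$, $G_k(i)\in\mathbb R^{n_x\times n_w}$ and the bias $c_k(i)\in\mathbb R^{n_x}$ are deterministic. The noise $w_k\in\mathbb R^{n_w}$ is white: $\mathbb E[w_k]=0$, $\mathbb E[w_kw_k^\top]=I$, and $\mathbb E[w_jw_k^\top]=0$ for $j\ne k$. The initial state $x_0$ has finite second moments. The initial state $x_0$, the noise process $(w_k)$ and the mode process $(r_k)$ are mutually independent. Definitions (with $\mathbf 1_{r_k=i}$ the indicator of the event $\{r_k=i\}$): $\rho_k(i)=\mathbb E[\mathbf 1_{r_k=i}]$; $q_k(i)=\mathbb E[x_k\mathbf 1_{r_k=i}]$; $\overline x_k(i)=\mathbb E[x_k\mid r_k=i]=q_k(i)/\rho_k(i)$; $S_k(i)=\mathbb E\big[(x_k-\overline x_k(i))(x_k-\overline x_k(i))^\top\mathbf 1_{r_k=i}\big]$. *)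

theory Defs
  imports "HOL-Probability.Probability"
begin

text \<open>The product of a column vector \<open>v\<close> with the row vector \<open>w\<^sup>T\<close>.\<close>

definition outer :: "real ^ 'n \<Rightarrow> real ^ 'm \<Rightarrow> real ^ 'm ^ 'n" where
  "outer v w = (\<chi> i j. v $ i * w $ j)"

definition stochastic_on :: "'s set \<Rightarrow> ('s \<Rightarrow> 's \<Rightarrow> real) \<Rightarrow> bool" where
  "stochastic_on S p \<longleftrightarrow> (\<forall>i\<in>S. (\<forall>j\<in>S. 0 \<le> p i j) \<and> (\<Sum>j\<in>S. p i j) = 1)"

text \<open>The Markov property is only required for histories \<open>s 0, \<dots>, s k\<close> of positive
  probability, where the conditional probability is meaningful.\<close>

definition markov_chain ::
  "'a measure \<Rightarrow> 's set \<Rightarrow> ('s \<Rightarrow> 's \<Rightarrow> real) \<Rightarrow> ('s \<Rightarrow> real) \<Rightarrow> (nat \<Rightarrow> 'a \<Rightarrow> 's) \<Rightarrow> bool" where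
  "markov_chain M S p init r \<longleftrightarrow>
     finite S \<and> stochastic_on S p \<and>
     (\<forall>k. r k \<in> measurable M (count_space S)) \<and>
     (\<forall>i\<in>S. measure M {\<omega> \<in> space M. r 0 \<omega> = i} = init i) \<and>
     (\<forall>k s. \<forall>j\<in>S. 0 < measure M {\<omega> \<in> space M. \<forall>l\<le>k. r l \<omega> = s l} \<longrightarrow>
        cond_prob M (\<lambda>\<omega>. r (Suc k) \<omega> = j) (\<lambda>\<omega>. \<forall>l\<le>k. r l \<omega> = s l) = p (s k) j)"

text \<open>Square integrability is stated explicitly because the Bochner integral of a
  non-integrable function is \<open>0\<close>; it makes all the expectations below genuine.\<close>

definition white_noise :: "'a measure \<Rightarrow> (nat \<Rightarrow> 'a \<Rightarrow> real ^ 'n) \<Rightarrow> bool" where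
  "white_noise M w \<longleftrightarrow>
     (\<forall>k. w k \<in> borel_measurable M \<and> integrable M (\<lambda>\<omega>. (norm (w k \<omega>))\<^sup>2)) \<and>
     (\<forall>k. integral\<^sup>L M (w k) = 0) \<and>
     (\<forall>k. integral\<^sup>L M (\<lambda>\<omega>. outer (w k \<omega>) (w k \<omega>)) = mat 1) \<and>
     (\<forall>j k. j \<noteq> k \<longrightarrow> integral\<^sup>L M (\<lambda>\<omega>. outer (w j \<omega>) (w k \<omega>)) = 0)"

definition process_sigma ::
  "'a measure \<Rightarrow> 'b measure \<Rightarrow> 't set \<Rightarrow> ('t \<Rightarrow> 'a \<Rightarrow> 'b) \<Rightarrow> 'a set set" where
  "process_sigma M N I X =
     sigma_sets (space M) {X t -` B \<inter> space M | t B. t \<in> I \<and> B \<in> sets N}"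

text \<open>The library's \<open>indep_vars\<close> needs all variables to take values in one type, so mutual
  independence is expressed through the generated sigma-algebras.\<close>

definition indep_init_noise_mode ::
  "'a measure \<Rightarrow> ('a \<Rightarrow> real ^ 'n) \<Rightarrow> (nat \<Rightarrow> 'a \<Rightarrow> real ^ 'm) \<Rightarrow> (nat \<Rightarrow> 'a \<Rightarrow> 's) \<Rightarrow> bool" where
  "indep_init_noise_mode M x0 w r \<longleftrightarrow>
     prob_space.indep_sets M
       (\<lambda>n. [process_sigma M borel {()} (\<lambda>_. x0),
             process_sigma M borel UNIV w,
             process_sigma M (count_space UNIV) UNIV r] ! n) {0, 1, 2}"

definition mode_prob :: "'a measure \<Rightarrow> (nat \<Rightarrow> 'a \<Rightarrow> 's) \<Rightarrow> nat \<Rightarrow> 's \<Rightarrow> real" where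
  "mode_prob M r k i = integral\<^sup>L M (\<lambda>\<omega>. indicator {i} (r k \<omega>))"

definition mode_moment ::
  "'a measure \<Rightarrow> (nat \<Rightarrow> 'a \<Rightarrow> 's) \<Rightarrow> (nat \<Rightarrow> 'a \<Rightarrow> real ^ 'n) \<Rightarrow> nat \<Rightarrow> 's \<Rightarrow> real ^ 'n" where
  "mode_moment M r x k i = integral\<^sup>L M (\<lambda>\<omega>. indicator {i} (r k \<omega>) *\<^sub>R x k \<omega>)"

definition mode_mean ::
  "'a measure \<Rightarrow> (nat \<Rightarrow> 'a \<Rightarrow> 's) \<Rightarrow> (nat \<Rightarrow> 'a \<Rightarrow> real ^ 'n) \<Rightarrow> nat \<Rightarrow> 's \<Rightarrow> real ^ 'n" where
  "mode_mean M r x k i = mode_moment M r x k i /\<^sub>R mode_prob M r k i"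

definition mode_cov ::
  "'a measure \<Rightarrow> (nat \<Rightarrow> 'a \<Rightarrow> 's) \<Rightarrow> (nat \<Rightarrow> 'a \<Rightarrow> real ^ 'n) \<Rightarrow> nat \<Rightarrow> 's \<Rightarrow> real ^ 'n ^ 'n" where
  "mode_cov M r x k i = integral\<^sup>L M (\<lambda>\<omega>. indicator {i} (r k \<omega>) *\<^sub>R
     outer (x k \<omega> - mode_mean M r x k i) (x k \<omega> - mode_mean M r x k i))"

end

theory Submission
  imports Defs
begin

text \<open>
  Substituting the policy gives the closed loop
  \<open>x (k+1) = F x k + d + G w k\<close> with \<open>F = A + B K\<close> and \<open>d = B (ubar - K xbar) + c\<close>, all evaluated
  at the current mode. The recursions follow from two facts about such an affine jump system.

  The first is that, given \<open>r k = i\<close>, the next mode is independent of \<open>(x k, w k)\<close>: inserting the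
  indicator of \<open>r (k+1) = j\<close> into an expectation over \<open>{r k = i}\<close> multiplies it by \<open>p i j\<close>
  (\<open>markov_step\<close>). The reason is that on the event that the modes up to time \<open>k\<close> follow a fixed path
  \<open>s\<close>, the state equals \<open>path_state s k\<close>, a fixed affine function of the initial state and the noise.
  This function is independent of the whole mode process, so its expectation over
  that event, intersected with any event of the mode process, splits into an expectation and a
  probability (\<open>mode_event_integral\<close>). The Markov property evaluates the probability
  path by path (\<open>path_extend\<close>), and summing over the finitely many paths ending in \<open>i\<close> gives the claim.

  The second is that \<open>x k\<close> and \<open>w k\<close> are uncorrelated on each event \<open>{r k = i}\<close>. White noise is
  only uncorrelated in time, so \<open>w k\<close> need not be independent of \<open>x k\<close>; but a path state is affine in
  the initial state and the earlier noise, and this is enough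
  (\<open>path_state_noise_uncorrelated\<close>, \<open>mode_state_noise\<close>).

  Together they give recursions for \<open>q\<close> and for the uncentred second moments
  \<open>E (x x\<^sup>T 1)\<close> (\<open>mode_moment_Suc\<close>, \<open>mode_second_moment_Suc\<close>). Since the modes have positive
  probability, \<open>q = rho xbar\<close> and the second moment is \<open>S + rho xbar xbar\<^sup>T\<close>
  (\<open>mode_second_moment_eq_cov\<close>); the rest is matrix algebra
  (\<open>feedback_second_moment\<close>).
\<close>

section \<open>Outer products and matrix identities\<close>

lemma bounded_bilinear_outer:
  "bounded_bilinear (outer :: real ^ 'n \<Rightarrow> real ^ 'm \<Rightarrow> real ^ 'm ^ 'n)"
  unfolding bilinear_conv_bounded_bilinear[symmetric] bilinear_def outer_def
  by (auto intro!: linearI simp: vec_eq_iff algebra_simps)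

lemmas outer_simps =
  bounded_bilinear.add_left[OF bounded_bilinear_outer]
  bounded_bilinear.add_right[OF bounded_bilinear_outer]
  bounded_bilinear.diff_left[OF bounded_bilinear_outer]
  bounded_bilinear.diff_right[OF bounded_bilinear_outer]
  bounded_bilinear.scaleR_left[OF bounded_bilinear_outer]
  bounded_bilinear.scaleR_right[OF bounded_bilinear_outer]
  bounded_bilinear.zero_left[OF bounded_bilinear_outer]
  bounded_bilinear.zero_right[OF bounded_bilinear_outer]

lemma outer_matrix_left: "outer (A *v v) w = A ** outer v w"
  by (simp add: outer_def vec_eq_iff matrix_vector_mult_def matrix_matrix_mult_def
      sum_distrib_right mult.assoc)

lemma outer_matrix_right: "outer v (A *v w) = outer v w ** transpose A"
  by (simp add: outer_def vec_eq_iff matrix_vector_mult_def matrix_matrix_mult_def transpose_def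
      sum_distrib_left mult.assoc mult.left_commute) (simp add: mult.commute)

lemma transpose_add: "transpose (A + B) = transpose A + transpose (B :: 'a::plus ^ 'n ^ 'm)"
  by (simp add: transpose_def vec_eq_iff)

lemma bounded_linear_matrix_left:
  "bounded_linear (\<lambda>X :: real ^ 'k ^ 'n. (A :: real ^ 'n ^ 'm) ** X)"
  unfolding linear_conv_bounded_linear[symmetric]
  by (rule linearI)
    (simp_all add: matrix_matrix_mult_def vec_eq_iff sum.distrib sum_distrib_left algebra_simps)

lemma bounded_linear_matrix_right:
  "bounded_linear (\<lambda>X :: real ^ 'n ^ 'm. X ** (A :: real ^ 'k ^ 'n))"
  unfolding linear_conv_bounded_linear[symmetric]
  by (rule linearI)
    (simp_all add: matrix_matrix_mult_def vec_eq_iff sum.distrib sum_distrib_left algebra_simps)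

lemma transpose_outer: "transpose (outer v w) = outer w v"
  by (simp add: transpose_def outer_def mult.commute)

lemma bounded_linear_transpose: "bounded_linear (transpose :: real ^ 'n ^ 'm \<Rightarrow> real ^ 'm ^ 'n)"
  unfolding linear_conv_bounded_linear[symmetric]
  by (rule linearI) (simp_all add: transpose_def vec_eq_iff)

text \<open>Passing to the mean \<open>F m + d\<close> of the image absorbs the cross terms; an affine map
  then acts on the centred part by congruence alone.\<close>

lemma second_moment_about_mean:
  fixes F :: "real ^ 'n ^ 'm"
  shows "F ** (C + \<rho> *\<^sub>R outer m m) ** transpose F
      + outer (F *v (\<rho> *\<^sub>R m)) d + outer d (F *v (\<rho> *\<^sub>R m)) + \<rho> *\<^sub>R (outer d d + W)
    = F ** C ** transpose F + \<rho> *\<^sub>R (outer (F *v m + d) (F *v m + d) + W)"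
  by (simp add: outer_simps outer_matrix_left outer_matrix_right matrix_vector_mult_scaleR
      linear_simps[OF bounded_linear_matrix_left] linear_simps[OF bounded_linear_matrix_right]
      scaleR_add_right add_ac matrix_mul_assoc)

text \<open>In \<open>d\<close> the feedback is centred at \<open>m\<close>, so \<open>K\<close> cancels from the mean:
  \<open>F m + d = A m + B u + c\<close>. The nine products of these three summands and the four of
  \<open>(A + B K) C (A + B K)\<^sup>T\<close> are the terms on the right.\<close>

lemma feedback_second_moment:
  fixes A :: "real ^ 'n ^ 'n" and B :: "real ^ 'u ^ 'n" and K :: "real ^ 'n ^ 'u"
    and G :: "real ^ 'w ^ 'n" and u :: "real ^ 'u" and m c :: "real ^ 'n"
  defines "F \<equiv> A + B ** K" and "d \<equiv> B *v (u - K *v m) + c"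
  shows "F ** (C + \<rho> *\<^sub>R outer m m) ** transpose F
      + outer (F *v (\<rho> *\<^sub>R m)) d + outer d (F *v (\<rho> *\<^sub>R m))
      + \<rho> *\<^sub>R (outer d d + G ** transpose G)
    = A ** C ** transpose A + A ** C ** transpose K ** transpose B
      + B ** K ** C ** transpose A
      + B ** (\<rho> *\<^sub>R outer u u + K ** C ** transpose K) ** transpose B
      + \<rho> *\<^sub>R (B ** outer u c + B ** outer u m ** transpose A + outer c c
         + A ** outer m u ** transpose B + outer c u ** transpose B
         + outer c m ** transpose A + G ** transpose G + A ** outer m c
         + A ** outer m m ** transpose A)"
proof -
  have mean: "F *v m + d = A *v m + B *v u + c"
    by (simp add: F_def d_def matrix_vector_mult_add_rdistrib matrix_vector_mult_diff_distrib
        matrix_vector_mul_assoc)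
  have "F ** C ** transpose F = A ** C ** transpose A + A ** C ** transpose K ** transpose B
      + B ** K ** C ** transpose A + B ** (K ** C ** transpose K) ** transpose B"
    by (simp add: F_def transpose_add matrix_transpose_mul matrix_mul_assoc
        linear_simps[OF bounded_linear_matrix_left] linear_simps[OF bounded_linear_matrix_right]
        matrix_add_ldistrib add_ac)
  then show ?thesis
    unfolding second_moment_about_mean mean
    by (simp add: outer_simps outer_matrix_left outer_matrix_right matrix_mul_assoc
        linear_simps[OF bounded_linear_matrix_left] linear_simps[OF bounded_linear_matrix_right]
        scaleR_add_right add_ac)
qed

section \<open>Square-integrable random vectors\<close>

lemma borel_measurable_bounded_linear:
  assumes "bounded_linear f" "X \<in> borel_measurable M"
  shows "(\<lambda>\<omega>. f (X \<omega>)) \<in> borel_measurable M"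
  using assms(2) borel_measurable_continuous_onI[OF linear_continuous_on[OF assms(1)]]
  by (rule measurable_compose)

definition square_integrable :: "'a measure \<Rightarrow> ('a \<Rightarrow> 'b::euclidean_space) \<Rightarrow> bool" where
  "square_integrable M X \<longleftrightarrow> X \<in> borel_measurable M \<and> integrable M (\<lambda>\<omega>. (norm (X \<omega>))\<^sup>2)"

lemma square_integrable_add:
  assumes "square_integrable M X" "square_integrable M Y"
  shows "square_integrable M (\<lambda>\<omega>. X \<omega> + Y \<omega>)"
proof -
  have [measurable]: "X \<in> borel_measurable M" "Y \<in> borel_measurable M"
    and XY: "integrable M (\<lambda>\<omega>. (norm (X \<omega>))\<^sup>2)" "integrable M (\<lambda>\<omega>. (norm (Y \<omega>))\<^sup>2)"
    using assms by (auto simp: square_integrable_def)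
  have bound: "(norm (a + b))\<^sup>2 \<le> 2 * (norm a)\<^sup>2 + 2 * (norm b)\<^sup>2" for a b :: 'b
  proof -
    have "(norm (a + b))\<^sup>2 \<le> (norm a + norm b)\<^sup>2"
      by (intro power_mono norm_triangle_ineq) auto
    also have "\<dots> \<le> 2 * (norm a)\<^sup>2 + 2 * (norm b)\<^sup>2"
      using sum_squares_ge_zero[of "norm a - norm b" 0]
      by (simp add: power2_eq_square algebra_simps)
    finally show ?thesis .
  qed
  have "integrable M (\<lambda>\<omega>. (norm (X \<omega> + Y \<omega>))\<^sup>2)"
    by (rule Bochner_Integration.integrable_bound
        [of _ "\<lambda>\<omega>. 2 * (norm (X \<omega>))\<^sup>2 + 2 * (norm (Y \<omega>))\<^sup>2"])
      (use XY bound in \<open>auto intro!: AE_I2\<close>)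
  then show ?thesis
    by (simp add: square_integrable_def)
qed

lemma square_integrable_matrix:
  fixes X :: "'a \<Rightarrow> real ^ 'n" and A :: "real ^ 'n ^ 'm"
  assumes "square_integrable M X"
  shows "square_integrable M (\<lambda>\<omega>. A *v X \<omega>)"
proof -
  have [measurable]: "X \<in> borel_measurable M"
    and X: "integrable M (\<lambda>\<omega>. (norm (X \<omega>))\<^sup>2)"
    using assms by (auto simp: square_integrable_def)
  have AX[measurable]: "(\<lambda>\<omega>. A *v X \<omega>) \<in> borel_measurable M"
    by (rule borel_measurable_bounded_linear[OF matrix_vector_mul_bounded_linear]) simp
  obtain b where b: "\<And>v. norm (A *v v) \<le> norm v * b"
    using bounded_linear.bounded[OF matrix_vector_mul_bounded_linear[of A]] by blast
  have "integrable M (\<lambda>\<omega>. (norm (A *v X \<omega>))\<^sup>2)"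
  proof (rule Bochner_Integration.integrable_bound)
    show "integrable M (\<lambda>\<omega>. b\<^sup>2 * (norm (X \<omega>))\<^sup>2)"
      using X by simp
    have "(norm (A *v X \<omega>))\<^sup>2 \<le> b\<^sup>2 * (norm (X \<omega>))\<^sup>2" for \<omega>
      using power_mono[OF b, of "X \<omega>" 2] by (simp add: power_mult_distrib mult.commute)
    then show "AE \<omega> in M. norm ((norm (A *v X \<omega>))\<^sup>2) \<le> norm (b\<^sup>2 * (norm (X \<omega>))\<^sup>2)"
      by simp
  qed simp
  then show ?thesis
    using AX by (simp add: square_integrable_def)
qed

lemma (in finite_measure) square_integrable_const: "square_integrable M (\<lambda>_. v)"
  by (simp add: square_integrable_def)

lemma (in finite_measure) square_integrable_imp_integrable:
  assumes "square_integrable M X"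
  shows "integrable M X"
proof -
  have [measurable]: "X \<in> borel_measurable M" and X: "integrable M (\<lambda>\<omega>. (norm (X \<omega>))\<^sup>2)"
    using assms by (auto simp: square_integrable_def)
  have "a \<le> 1 + a\<^sup>2" for a :: real
    using sum_squares_ge_zero[of "a - 1" "a"] by (simp add: power2_eq_square algebra_simps)
  then show ?thesis
    by (intro Bochner_Integration.integrable_bound[of M "\<lambda>\<omega>. 1 + (norm (X \<omega>))\<^sup>2" X])
      (use X in \<open>auto intro!: AE_I2\<close>)
qed

lemma borel_measurable_outer [measurable]:
  fixes X :: "'a \<Rightarrow> real ^ 'n" and Y :: "'a \<Rightarrow> real ^ 'm"
  assumes "X \<in> borel_measurable M" "Y \<in> borel_measurable M"
  shows "(\<lambda>\<omega>. outer (X \<omega>) (Y \<omega>)) \<in> borel_measurable M"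
  using assms
  by (intro borel_measurable_continuous_Pair[of X M Y outer]
      bounded_bilinear.continuous_on[OF bounded_bilinear_outer] continuous_intros)

lemma square_integrable_imp_integrable_outer:
  fixes X :: "'a \<Rightarrow> real ^ 'n" and Y :: "'a \<Rightarrow> real ^ 'm"
  assumes "square_integrable M X" "square_integrable M Y"
  shows "integrable M (\<lambda>\<omega>. outer (X \<omega>) (Y \<omega>))"
proof -
  have [measurable]: "X \<in> borel_measurable M" "Y \<in> borel_measurable M"
    and XY: "integrable M (\<lambda>\<omega>. (norm (X \<omega>))\<^sup>2)" "integrable M (\<lambda>\<omega>. (norm (Y \<omega>))\<^sup>2)"
    using assms by (auto simp: square_integrable_def)
  obtain b where b: "b \<ge> 0"
      "\<And>v w. norm (outer v w :: real ^ 'm ^ 'n) \<le> norm v * norm w * b"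
    using bounded_bilinear.nonneg_bounded[OF bounded_bilinear_outer] by blast
  have ab: "s * t \<le> s\<^sup>2 + t\<^sup>2" for s t :: real
    using sum_squares_bound[of s t] zero_le_power2[of s] zero_le_power2[of t] by linarith
  have "norm (outer (X \<omega>) (Y \<omega>)) \<le> b * ((norm (X \<omega>))\<^sup>2 + (norm (Y \<omega>))\<^sup>2)" for \<omega>
    using b(2)[of "X \<omega>" "Y \<omega>"] mult_left_mono[OF ab b(1), of "norm (X \<omega>)" "norm (Y \<omega>)"]
    by (simp add: mult_ac)
  then show ?thesis
    by (intro Bochner_Integration.integrable_bound
        [of M "\<lambda>\<omega>. b * ((norm (X \<omega>))\<^sup>2 + (norm (Y \<omega>))\<^sup>2)" "\<lambda>\<omega>. outer (X \<omega>) (Y \<omega>)"])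
      (use XY b(1) in \<open>auto intro!: AE_I2\<close>)
qed

section \<open>Expectations of products under independence\<close>

text \<open>Independence is used below between two generated \<open>\<sigma>\<close>-algebras, represented as measure spaces
  \<open>F\<close> and \<open>H\<close> over the same points so that measurability with respect to them can be expressed.\<close>

context prob_space
begin

lemma indep_var_of_indep_set:
  assumes indep: "indep_set (sets F) (sets H)"
    and sp: "space F = space M" "space H = space M"
    and X: "X \<in> measurable F N" and Y: "Y \<in> measurable H L"
  shows "indep_var N X L Y"
proof -
  have FH: "sets F \<subseteq> events" "sets H \<subseteq> events"
    using indep by (auto simp: indep_set_def indep_sets_def split: bool.splits)
  have rv: "random_variable N X" "random_variable L Y"
    using X Y FH sp by (auto simp: measurable_def)
  have sub: "sigma_sets (space M) {Z -` B \<inter> space M | B. B \<in> sets L'} \<subseteq> sets F'"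
    if "Z \<in> measurable F' L'" "space F' = space M" for Z L' F'
    using that by (intro sets.sigma_sets_subset[of _ F', simplified that]) (auto simp: measurable_def)
  have "indep_set (sigma_sets (space M) {X -` B \<inter> space M | B. B \<in> sets N})
      (sigma_sets (space M) {Y -` B \<inter> space M | B. B \<in> sets L})"
    using indep sub[OF X sp(1)] sub[OF Y sp(2)] unfolding indep_set_def
    by (elim indep_sets_mono_sets) (auto split: bool.splits)
  with rv show ?thesis
    by (simp add: indep_var_eq)
qed

lemma indep_integral_scaleR:
  fixes X :: "'a \<Rightarrow> 'b::euclidean_space" and Y :: "'a \<Rightarrow> real"
  assumes indep: "indep_set (sets F) (sets H)"
    and sp: "space F = space M" "space H = space M"
    and X: "X \<in> borel_measurable F" "integrable M X"
    and Y: "Y \<in> borel_measurable H" "integrable M Y"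
  shows "integrable M (\<lambda>\<omega>. Y \<omega> *\<^sub>R X \<omega>)"
    and "(\<integral>\<omega>. Y \<omega> *\<^sub>R X \<omega> \<partial>M) = (\<integral>\<omega>. Y \<omega> \<partial>M) *\<^sub>R (\<integral>\<omega>. X \<omega> \<partial>M)"
proof -
  have iv: "indep_var borel (\<lambda>\<omega>. X \<omega> \<bullet> b) borel Y" for b
    by (rule indep_var_of_indep_set[OF indep sp _ Y(1)]) (use X in measurable)
  have iX: "integrable M (\<lambda>\<omega>. X \<omega> \<bullet> b)" for b
    using X(2) by simp
  have comp: "integrable M (\<lambda>\<omega>. (Y \<omega> *\<^sub>R X \<omega>) \<bullet> b)" for b
    using indep_var_integrable[OF iv iX Y(2)] by (simp add: mult.commute)
  show int: "integrable M (\<lambda>\<omega>. Y \<omega> *\<^sub>R X \<omega>)"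
  proof -
    have "integrable M (\<lambda>\<omega>. \<Sum>b\<in>Basis. ((Y \<omega> *\<^sub>R X \<omega>) \<bullet> b) *\<^sub>R b)"
      using comp by (intro Bochner_Integration.integrable_sum integrable_scaleR_left) auto
    then show ?thesis
      by (simp only: euclidean_representation)
  qed
  show "(\<integral>\<omega>. Y \<omega> *\<^sub>R X \<omega> \<partial>M) = (\<integral>\<omega>. Y \<omega> \<partial>M) *\<^sub>R (\<integral>\<omega>. X \<omega> \<partial>M)"
  proof (rule euclidean_eqI)
    fix b :: 'b
    have "(\<integral>\<omega>. Y \<omega> *\<^sub>R X \<omega> \<partial>M) \<bullet> b = (\<integral>\<omega>. (X \<omega> \<bullet> b) * Y \<omega> \<partial>M)"
      using int by (subst integral_inner_left[symmetric]) (simp_all add: mult.commute)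
    also have "\<dots> = (\<integral>\<omega>. X \<omega> \<bullet> b \<partial>M) * (\<integral>\<omega>. Y \<omega> \<partial>M)"
      by (rule indep_var_lebesgue_integral[OF iv iX Y(2)])
    finally show "(\<integral>\<omega>. Y \<omega> *\<^sub>R X \<omega> \<partial>M) \<bullet> b = ((\<integral>\<omega>. Y \<omega> \<partial>M) *\<^sub>R (\<integral>\<omega>. X \<omega> \<partial>M)) \<bullet> b"
      using X(2) by (simp add: mult.commute)
  qed
qed

lemma indep_integral_outer:
  fixes X :: "'a \<Rightarrow> real ^ 'n" and Y :: "'a \<Rightarrow> real ^ 'm"
  assumes indep: "indep_set (sets F) (sets H)"
    and sp: "space F = space M" "space H = space M"
    and X: "X \<in> borel_measurable F" "square_integrable M X"
    and Y: "Y \<in> borel_measurable H" "square_integrable M Y"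
  shows "(\<integral>\<omega>. outer (X \<omega>) (Y \<omega>) \<partial>M) = outer (\<integral>\<omega>. X \<omega> \<partial>M) (\<integral>\<omega>. Y \<omega> \<partial>M)"
proof -
  have iX: "integrable M X" and iY: "integrable M Y"
    and iXY: "integrable M (\<lambda>\<omega>. outer (X \<omega>) (Y \<omega>))"
    using X(2) Y(2)
    by (auto intro: square_integrable_imp_integrable square_integrable_imp_integrable_outer)
  have comp: "(\<integral>\<omega>. Z \<omega> $ i \<partial>M) = (\<integral>\<omega>. Z \<omega> \<partial>M) $ i" if "integrable M Z"
    for Z :: "'a \<Rightarrow> 'c::euclidean_space ^ 'd" and i
    by (rule integral_bounded_linear[OF bounded_linear_vec_nth that])
  have "(\<integral>\<omega>. outer (X \<omega>) (Y \<omega>) \<partial>M) $ i $ j = (\<integral>\<omega>. X \<omega> \<partial>M) $ i * (\<integral>\<omega>. Y \<omega> \<partial>M) $ j" for i j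
  proof -
    have iXi: "integrable M (\<lambda>\<omega>. X \<omega> $ i)" and iYj: "integrable M (\<lambda>\<omega>. Y \<omega> $ j)"
      and iXYi: "integrable M (\<lambda>\<omega>. outer (X \<omega>) (Y \<omega>) $ i)"
      using iX iY iXY by (auto intro: integrable_bounded_linear[OF bounded_linear_vec_nth])
    have m: "(\<lambda>\<omega>. X \<omega> $ i) \<in> borel_measurable F" "(\<lambda>\<omega>. Y \<omega> $ j) \<in> borel_measurable H"
      using X(1) Y(1) by (auto intro: borel_measurable_bounded_linear[OF bounded_linear_vec_nth])
    have "(\<integral>\<omega>. outer (X \<omega>) (Y \<omega>) \<partial>M) $ i $ j = (\<integral>\<omega>. Y \<omega> $ j *\<^sub>R X \<omega> $ i \<partial>M)"
      by (simp add: comp[OF iXY, symmetric] comp[OF iXYi, symmetric])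
        (simp add: outer_def mult.commute)
    also have "\<dots> = (\<integral>\<omega>. Y \<omega> $ j \<partial>M) * (\<integral>\<omega>. X \<omega> $ i \<partial>M)"
      using indep_integral_scaleR(2)[OF indep sp m(1) iXi m(2) iYj] by simp
    finally show ?thesis
      by (simp add: comp[OF iX] comp[OF iY])
  qed
  then show ?thesis
    by (simp add: vec_eq_iff outer_def)
qed

end


section \<open>Generated sigma-algebras\<close>

lemma sets_sigma_process_sigma:
  "sets (sigma (space M) (process_sigma M N I X)) = process_sigma M N I X"
  unfolding process_sigma_def
  by (subst sets_measure_of) (auto intro!: sigma_sets_sigma_sets_eq dest: sigma_sets_into_sp[rotated])

lemma sigma_sets_process_sigma:
  "sigma_sets (space M) (process_sigma M N I X) = process_sigma M N I X"
  unfolding process_sigma_def by (rule sigma_sets_sigma_sets_eq) auto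

lemma Int_stable_process_sigma: "Int_stable (process_sigma M N I X)"
  unfolding Int_stable_def
  by (metis sets.Int sets_sigma_process_sigma)

lemma process_sigma_subset_Pow: "process_sigma M N I X \<subseteq> Pow (space M)"
  unfolding process_sigma_def by (auto dest: sigma_sets_into_sp[rotated])

lemma measurable_process:
  assumes "t \<in> I" "process_sigma M N I X \<subseteq> C" "C \<subseteq> Pow (space M)"
    and "X t \<in> space M \<rightarrow> space N"
  shows "X t \<in> measurable (sigma (space M) C) N"
proof (rule measurableI)
  fix A assume A: "A \<in> sets N"
  then have "X t -` A \<inter> space M \<in> process_sigma M N I X"
    using assms(1) unfolding process_sigma_def by (intro sigma_sets.Basic) blast
  then show "X t -` A \<inter> space (sigma (space M) C) \<in> sets (sigma (space M) C)"
    using assms(2,3) by (auto simp: space_measure_of_conv)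
qed (use assms(4) in \<open>auto simp: space_measure_of_conv\<close>)

section \<open>Affine jump systems\<close>

locale jump_affine_system = prob_space M for M :: "'a measure" +
  fixes S :: "'s set" and p :: "'s \<Rightarrow> 's \<Rightarrow> real" and init :: "'s \<Rightarrow> real"
    and r :: "nat \<Rightarrow> 'a \<Rightarrow> 's"
    and x :: "nat \<Rightarrow> 'a \<Rightarrow> real ^ 'nx" and w :: "nat \<Rightarrow> 'a \<Rightarrow> real ^ 'nw"
    and F :: "nat \<Rightarrow> 's \<Rightarrow> real ^ 'nx ^ 'nx" and d :: "nat \<Rightarrow> 's \<Rightarrow> real ^ 'nx"
    and G :: "nat \<Rightarrow> 's \<Rightarrow> real ^ 'nw ^ 'nx" and T :: nat
  assumes chain: "markov_chain M S p init r"
    and noise: "white_noise M w"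
    and x0: "square_integrable M (x 0)"
    and indep: "indep_init_noise_mode M (x 0) w r"
    and dynamics: "\<And>k \<omega>. k < T \<Longrightarrow> \<omega> \<in> space M \<Longrightarrow>
      x (Suc k) \<omega> = F k (r k \<omega>) *v x k \<omega> + d k (r k \<omega>) + G k (r k \<omega>) *v w k \<omega>"
begin

lemma finite_modes: "finite S"
  using chain by (simp add: markov_chain_def)

lemma mode_in: "\<omega> \<in> space M \<Longrightarrow> r k \<omega> \<in> S"
  using chain measurable_space[of "r k" M "count_space S" \<omega>] by (simp add: markov_chain_def)

lemma noise_square_integrable: "square_integrable M (w k)"
  using noise by (simp add: white_noise_def square_integrable_def)

definition driver :: "'a measure" where
  "driver = sigma (space M)
     (process_sigma M borel {()} (\<lambda>_. x 0) \<union> process_sigma M borel UNIV w)"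

definition modes :: "'a measure" where
  "modes = sigma (space M) (process_sigma M (count_space UNIV) UNIV r)"

lemma space_driver [simp]: "space driver = space M"
  and space_modes [simp]: "space modes = space M"
  by (simp_all add: driver_def modes_def space_measure_of_conv)

text \<open>Of three mutually independent families the first two may be merged, since each is closed under
  intersection.\<close>

lemma indep_driver_modes: "indep_set (sets driver) (sets modes)"
proof -
  let ?L = "(!) [process_sigma M borel {()} (\<lambda>_. x 0), process_sigma M borel UNIV w,
      process_sigma M (count_space UNIV) UNIV r]"
  let ?I = "case_bool {0, 1} {2} :: bool \<Rightarrow> nat set"
  have "indep_sets ?L (\<Union>j\<in>UNIV. ?I j)"
    using indep by (simp add: indep_init_noise_mode_def UNIV_bool insert_commute)
  then have "indep_sets (\<lambda>j. sigma_sets (space M) (\<Union>i\<in>?I j. ?L i)) UNIV"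
    by (rule indep_sets_collect_sigma)
      (auto simp: disjoint_family_on_def Int_stable_process_sigma split: bool.splits)
  moreover have "(\<lambda>j. sigma_sets (space M) (\<Union>i\<in>?I j. ?L i)) = case_bool (sets driver) (sets modes)"
    by (simp add: fun_eq_iff driver_def modes_def sets_measure_of process_sigma_subset_Pow
        split: bool.splits)
  ultimately show ?thesis
    by (simp add: indep_set_def)
qed

lemma indep_init_noise:
  "indep_set (process_sigma M borel {()} (\<lambda>_. x 0)) (process_sigma M borel UNIV w)"
proof -
  let ?L = "(!) [process_sigma M borel {()} (\<lambda>_. x 0), process_sigma M borel UNIV w,
      process_sigma M (count_space UNIV) UNIV r]"
  let ?I = "case_bool {0} {1} :: bool \<Rightarrow> nat set"
  have "indep_sets ?L (\<Union>j\<in>UNIV. ?I j)"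
    using indep unfolding indep_init_noise_mode_def
    by (rule indep_sets_mono_index[rotated]) (auto split: bool.splits)
  then have "indep_sets (\<lambda>j. sigma_sets (space M) (\<Union>i\<in>?I j. ?L i)) UNIV"
    by (rule indep_sets_collect_sigma)
      (auto simp: disjoint_family_on_def Int_stable_process_sigma split: bool.splits)
  moreover have "(\<lambda>j. sigma_sets (space M) (\<Union>i\<in>?I j. ?L i)) = case_bool
      (process_sigma M borel {()} (\<lambda>_. x 0)) (process_sigma M borel UNIV w)"
    by (auto simp: fun_eq_iff sigma_sets_process_sigma split: bool.splits)
  ultimately show ?thesis
    by (simp add: indep_set_def)
qed

lemma init_driver [measurable]: "x 0 \<in> borel_measurable driver"
  unfolding driver_def
  by (rule measurable_process[of "()" "{()}" M borel "\<lambda>_. x 0"])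
    (simp_all add: process_sigma_subset_Pow)

lemma noise_driver [measurable]: "w k \<in> borel_measurable driver"
  unfolding driver_def
  by (rule measurable_process[of k UNIV M borel w]) (simp_all add: process_sigma_subset_Pow)

lemma modes_measurable [measurable]: "r k \<in> measurable modes (count_space UNIV)"
  unfolding modes_def
  by (rule measurable_process[of k UNIV]) (auto simp: process_sigma_subset_Pow)

lemma noise_mean: "(\<integral>\<omega>. w k \<omega> \<partial>M) = 0"
  and noise_cov: "(\<integral>\<omega>. outer (w k \<omega>) (w k \<omega>) \<partial>M) = mat 1"
  and noise_white: "l \<noteq> k \<Longrightarrow> (\<integral>\<omega>. outer (w l \<omega>) (w k \<omega>) \<partial>M) = 0"
  using noise unfolding white_noise_def by blast+

lemma expectation_init_noise: "(\<integral>\<omega>. outer (x 0 \<omega>) (w k \<omega>) \<partial>M) = 0"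
proof -
  let ?X = "sigma (space M) (process_sigma M borel {()} (\<lambda>_. x 0))"
  let ?W = "sigma (space M) (process_sigma M borel UNIV w)"
  have "(\<integral>\<omega>. outer (x 0 \<omega>) (w k \<omega>) \<partial>M) = outer (\<integral>\<omega>. x 0 \<omega> \<partial>M) (\<integral>\<omega>. w k \<omega> \<partial>M)"
  proof (rule indep_integral_outer)
    show "indep_set (sets ?X) (sets ?W)"
      using indep_init_noise by (simp add: sets_sigma_process_sigma)
    show "x 0 \<in> borel_measurable ?X"
      by (rule measurable_process[of "()" "{()}" _ _ "\<lambda>_. x 0"]) (auto simp: process_sigma_subset_Pow)
    show "w k \<in> borel_measurable ?W"
      by (rule measurable_process[of k UNIV]) (auto simp: process_sigma_subset_Pow)
  qed (simp_all add: x0 noise_square_integrable space_measure_of_conv)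
  also have "\<dots> = 0"
    by (simp add: noise_mean outer_simps)
  finally show ?thesis .
qed

text \<open>Prescribing the modes by a deterministic \<open>s\<close> removes the dependence of the state on the mode
  process, while agreeing with the actual state wherever the modes do follow \<open>s\<close>.\<close>

primrec path_state :: "(nat \<Rightarrow> 's) \<Rightarrow> nat \<Rightarrow> 'a \<Rightarrow> real ^ 'nx" where
  "path_state s 0 \<omega> = x 0 \<omega>"
| "path_state s (Suc k) \<omega> = F k (s k) *v path_state s k \<omega> + d k (s k) + G k (s k) *v w k \<omega>"

lemma state_eq_path_state:
  assumes "k \<le> T" "\<omega> \<in> space M" "\<And>l. l < k \<Longrightarrow> r l \<omega> = s l"
  shows "x k \<omega> = path_state s k \<omega>"
  using assms by (induction k) (simp_all add: dynamics)

lemma path_state_measurable [measurable]: "path_state s k \<in> borel_measurable driver"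
proof (induction k)
  case 0
  have "path_state s 0 = x 0" by (simp add: fun_eq_iff)
  then show ?case by simp
next
  case (Suc k)
  note [measurable] = borel_measurable_bounded_linear[OF matrix_vector_mul_bounded_linear Suc]
    borel_measurable_bounded_linear[OF matrix_vector_mul_bounded_linear noise_driver]
  have "path_state s (Suc k)
      = (\<lambda>\<omega>. F k (s k) *v path_state s k \<omega> + d k (s k) + G k (s k) *v w k \<omega>)"
    by (simp add: fun_eq_iff)
  then show ?case by simp
qed

lemma path_state_square_integrable: "square_integrable M (path_state s k)"
proof (induction k)
  case 0
  have "path_state s 0 = x 0" by (simp add: fun_eq_iff)
  then show ?case by (simp add: x0)
next
  case (Suc k)
  have "path_state s (Suc k)
      = (\<lambda>\<omega>. F k (s k) *v path_state s k \<omega> + d k (s k) + G k (s k) *v w k \<omega>)"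
    by (simp add: fun_eq_iff)
  then show ?case
    by (simp add: Suc square_integrable_add square_integrable_matrix square_integrable_const
        noise_square_integrable)
qed

text \<open>The path state at time \<open>l\<close> is affine in \<open>x 0\<close> and the noise before \<open>l\<close>. Its correlation
  with \<open>w k\<close> therefore reduces to those of \<open>w k\<close> with \<open>x 0\<close>, with constants and with earlier
  noise, and all of them vanish.\<close>

lemma path_state_noise_uncorrelated:
  assumes "l \<le> k"
  shows "(\<integral>\<omega>. outer (path_state s l \<omega>) (w k \<omega>) \<partial>M) = 0"
  using assms
proof (induction l)
  case 0
  then show ?case by (simp add: expectation_init_noise)
next
  case (Suc l)
  have i1: "integrable M (\<lambda>\<omega>. outer (path_state s l \<omega>) (w k \<omega>))"
    and i2: "integrable M (\<lambda>\<omega>. outer (w l \<omega>) (w k \<omega>))" and i3: "integrable M (w k)"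
    by (auto intro: square_integrable_imp_integrable_outer square_integrable_imp_integrable
        path_state_square_integrable noise_square_integrable)
  note L = bounded_linear_matrix_left
  note D = bounded_bilinear.bounded_linear_right[OF bounded_bilinear_outer]
  have "(\<integral>\<omega>. outer (path_state s (Suc l) \<omega>) (w k \<omega>) \<partial>M)
      = (\<integral>\<omega>. F l (s l) ** outer (path_state s l \<omega>) (w k \<omega>) + outer (d l (s l)) (w k \<omega>)
          + G l (s l) ** outer (w l \<omega>) (w k \<omega>) \<partial>M)"
    by (simp add: outer_simps outer_matrix_left)
  also have "\<dots> = F l (s l) ** (\<integral>\<omega>. outer (path_state s l \<omega>) (w k \<omega>) \<partial>M)
      + outer (d l (s l)) (\<integral>\<omega>. w k \<omega> \<partial>M) + G l (s l) ** (\<integral>\<omega>. outer (w l \<omega>) (w k \<omega>) \<partial>M)"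
    by (intro has_bochner_integral_integral_eq has_bochner_integral_add
        has_bochner_integral_bounded_linear[OF L] has_bochner_integral_bounded_linear[OF D]
        has_bochner_integral_integrable i1 i2 i3)
  also have "\<dots> = 0"
    using Suc by (simp add: noise_mean noise_white outer_simps)
  finally show ?case .
qed

section \<open>Decomposition over mode paths\<close>

definition path_event :: "nat \<Rightarrow> (nat \<Rightarrow> 's) \<Rightarrow> 'a set" where
  "path_event k s = {\<omega> \<in> space M. \<forall>l\<le>k. r l \<omega> = s l}"

definition paths_to :: "nat \<Rightarrow> 's \<Rightarrow> (nat \<Rightarrow> 's) set" where
  "paths_to k i = {s \<in> {..k} \<rightarrow>\<^sub>E S. s k = i}"

lemma path_event_modes [measurable]: "path_event k s \<in> sets modes"
proof -
  have "path_event k s = (\<Inter>l\<in>{..k}. r l -` {s l} \<inter> space modes)"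
    by (auto simp: path_event_def)
  also have "\<dots> \<in> sets modes"
    by (intro sets.finite_INT measurable_sets[OF modes_measurable]) auto
  finally show ?thesis .
qed

lemma sets_modes_events: "C \<in> sets modes \<Longrightarrow> C \<in> events"
  using indep_driver_modes by (auto simp: indep_set_def indep_sets_def split: bool.splits)

lemma finite_paths_to: "finite (paths_to k i)"
  unfolding paths_to_def by (simp add: finite_PiE finite_modes)

text \<open>The events of the paths ending in \<open>i\<close> partition \<open>{r k = i}\<close>, and the path followed by an
  outcome is the restriction of its mode trajectory.\<close>

lemma sum_paths_to:
  fixes f :: "(nat \<Rightarrow> 's) \<Rightarrow> 'b::real_vector"
  assumes "\<omega> \<in> space M"
  shows "(\<Sum>s\<in>paths_to k i. indicator (path_event k s) \<omega> *\<^sub>R f s)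
    = indicator {i} (r k \<omega>) *\<^sub>R f (restrict (\<lambda>l. r l \<omega>) {..k})"
proof -
  let ?s = "restrict (\<lambda>l. r l \<omega>) {..k}"
  have eq: "indicator (path_event k s) \<omega> = (if s = ?s then 1 else 0 :: real)"
    if "s \<in> paths_to k i" for s
    using that assms
    by (auto simp: paths_to_def path_event_def indicator_def PiE_iff extensional_def fun_eq_iff)
  have "?s \<in> paths_to k i \<longleftrightarrow> r k \<omega> = i"
    using assms mode_in by (auto simp: paths_to_def)
  moreover have "(\<Sum>s\<in>paths_to k i. indicator (path_event k s) \<omega> *\<^sub>R f s)
      = (\<Sum>s\<in>paths_to k i. if s = ?s then f s else 0)"
    by (intro sum.cong refl) (simp add: eq)
  ultimately show ?thesis
    by (simp add: sum.delta'[OF finite_paths_to] sum.delta[OF finite_paths_to])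
qed

text \<open>On a path event the state is the path state, which is independent of the mode process and hence
  of the path event and of \<open>C\<close>. Since \<open>h\<close> only sees the state and the noise at time \<open>k\<close>, the
  integral splits over the paths into products.\<close>

lemma mode_event_integral:
  fixes h :: "real ^ 'nx \<Rightarrow> real ^ 'nw \<Rightarrow> 'b::euclidean_space"
  assumes k: "k \<le> T" and C: "C \<in> sets modes"
    and meas: "\<And>s. (\<lambda>\<omega>. h (path_state s k \<omega>) (w k \<omega>)) \<in> borel_measurable driver"
    and int: "\<And>s. integrable M (\<lambda>\<omega>. h (path_state s k \<omega>) (w k \<omega>))"
  shows "has_bochner_integral M
      (\<lambda>\<omega>. indicator C \<omega> *\<^sub>R indicator {i} (r k \<omega>) *\<^sub>R h (x k \<omega>) (w k \<omega>))
      (\<Sum>s\<in>paths_to k i. prob (path_event k s \<inter> C) *\<^sub>R (\<integral>\<omega>. h (path_state s k \<omega>) (w k \<omega>) \<partial>M))"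
proof -
  let ?h = "\<lambda>s \<omega>. h (path_state s k \<omega>) (w k \<omega>)"
  have part: "has_bochner_integral M (\<lambda>\<omega>. indicator (path_event k s \<inter> C) \<omega> *\<^sub>R ?h s \<omega>)
      (prob (path_event k s \<inter> C) *\<^sub>R (\<integral>\<omega>. ?h s \<omega> \<partial>M))" for s
  proof -
    have E: "path_event k s \<inter> C \<in> sets modes"
      using C by measurable
    then have Y: "(indicator (path_event k s \<inter> C) :: 'a \<Rightarrow> real) \<in> borel_measurable modes"
      "integrable M (indicator (path_event k s \<inter> C) :: 'a \<Rightarrow> real)"
      using sets_modes_events[OF E]
      by (auto intro: borel_measurable_indicator integrable_real_indicator simp: emeasure_eq_measure)
    show ?thesis
      unfolding has_bochner_integral_iff
      using indep_integral_scaleR[where X = "?h s",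
          OF indep_driver_modes space_driver space_modes meas int Y]
        sets_modes_events[OF E] by simp
  qed
  have "(\<Sum>s\<in>paths_to k i. indicator (path_event k s \<inter> C) \<omega> *\<^sub>R ?h s \<omega>)
      = indicator C \<omega> *\<^sub>R indicator {i} (r k \<omega>) *\<^sub>R h (x k \<omega>) (w k \<omega>)" if "\<omega> \<in> space M" for \<omega>
  proof -
    have "x k \<omega> = path_state (restrict (\<lambda>l. r l \<omega>) {..k}) k \<omega>"
      by (rule state_eq_path_state[OF k that]) simp
    then show ?thesis
      using sum_paths_to[OF that, where k = k and i = i and f = "\<lambda>s. indicator C \<omega> *\<^sub>R ?h s \<omega>"]
      by (simp add: indicator_inter_arith mult.commute)
  qed
  moreover have "has_bochner_integral M
      (\<lambda>\<omega>. \<Sum>s\<in>paths_to k i. indicator (path_event k s \<inter> C) \<omega> *\<^sub>R ?h s \<omega>)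
      (\<Sum>s\<in>paths_to k i. prob (path_event k s \<inter> C) *\<^sub>R (\<integral>\<omega>. ?h s \<omega> \<partial>M))"
    by (intro has_bochner_integral_sum part)
  ultimately show ?thesis
    by (auto cong: has_bochner_integral_cong)
qed

text \<open>The Markov property conditions only on paths of positive probability; for the
  others both sides vanish.\<close>

lemma path_extend:
  assumes "j \<in> S"
  shows "prob (path_event k s \<inter> {\<omega> \<in> space M. r (Suc k) \<omega> = j}) = p (s k) j * prob (path_event k s)"
proof (cases "prob (path_event k s) = 0")
  case True
  have "prob (path_event k s \<inter> {\<omega> \<in> space M. r (Suc k) \<omega> = j}) \<le> prob (path_event k s)"
    by (intro finite_measure_mono) (auto intro: sets_modes_events)
  with True show ?thesis
    by (simp add: measure_le_0_iff)
next
  case False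
  then have pos: "0 < prob (path_event k s)"
    by (simp add: zero_less_measure_iff)
  then have "cond_prob M (\<lambda>\<omega>. r (Suc k) \<omega> = j) (\<lambda>\<omega>. \<forall>l\<le>k. r l \<omega> = s l) = p (s k) j"
    using chain assms unfolding markov_chain_def path_event_def by blast
  moreover have "path_event k s \<inter> {\<omega> \<in> space M. r (Suc k) \<omega> = j}
      = {\<omega> \<in> space M. r (Suc k) \<omega> = j \<and> (\<forall>l\<le>k. r l \<omega> = s l)}"
    by (auto simp: path_event_def)
  ultimately show ?thesis
    using pos by (simp add: cond_prob_def path_event_def field_simps)
qed

lemma mode_integral_paths:
  fixes h :: "real ^ 'nx \<Rightarrow> real ^ 'nw \<Rightarrow> 'b::euclidean_space"
  assumes k: "k \<le> T"
    and meas: "\<And>s. (\<lambda>\<omega>. h (path_state s k \<omega>) (w k \<omega>)) \<in> borel_measurable driver"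
    and int: "\<And>s. integrable M (\<lambda>\<omega>. h (path_state s k \<omega>) (w k \<omega>))"
  shows "has_bochner_integral M (\<lambda>\<omega>. indicator {i} (r k \<omega>) *\<^sub>R h (x k \<omega>) (w k \<omega>))
    (\<Sum>s\<in>paths_to k i. prob (path_event k s) *\<^sub>R (\<integral>\<omega>. h (path_state s k \<omega>) (w k \<omega>) \<partial>M))"
proof -
  have "space M \<in> sets modes"
    using sets.top[of modes] by simp
  with k have "has_bochner_integral M
      (\<lambda>\<omega>. indicator (space M) \<omega> *\<^sub>R indicator {i} (r k \<omega>) *\<^sub>R h (x k \<omega>) (w k \<omega>))
      (\<Sum>s\<in>paths_to k i. prob (path_event k s \<inter> space M) *\<^sub>R
        (\<integral>\<omega>. h (path_state s k \<omega>) (w k \<omega>) \<partial>M))"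
    by (rule mode_event_integral[where h = h]) (rule meas int)+
  moreover have "path_event k s \<inter> space M = path_event k s" for s
    unfolding path_event_def by blast
  ultimately have "has_bochner_integral M
      (\<lambda>\<omega>. indicator (space M) \<omega> *\<^sub>R indicator {i} (r k \<omega>) *\<^sub>R h (x k \<omega>) (w k \<omega>))
      (\<Sum>s\<in>paths_to k i. prob (path_event k s) *\<^sub>R (\<integral>\<omega>. h (path_state s k \<omega>) (w k \<omega>) \<partial>M))"
    by simp
  then show ?thesis
    by (rule has_bochner_integral_cong[THEN iffD1, rotated -1]) auto
qed

text \<open>Every path in the decomposition of \<open>{r k = i}\<close> ends in \<open>i\<close>, so the transition probability
  contributed by its extension to \<open>j\<close> is the same factor \<open>p i j\<close> throughout.\<close>

lemma markov_step:
  fixes h :: "real ^ 'nx \<Rightarrow> real ^ 'nw \<Rightarrow> 'b::euclidean_space"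
  assumes k: "k \<le> T" and j: "j \<in> S"
    and meas: "\<And>s. (\<lambda>\<omega>. h (path_state s k \<omega>) (w k \<omega>)) \<in> borel_measurable driver"
    and int: "\<And>s. integrable M (\<lambda>\<omega>. h (path_state s k \<omega>) (w k \<omega>))"
  shows "has_bochner_integral M
      (\<lambda>\<omega>. indicator {j} (r (Suc k) \<omega>) *\<^sub>R indicator {i} (r k \<omega>) *\<^sub>R h (x k \<omega>) (w k \<omega>))
      (p i j *\<^sub>R (\<integral>\<omega>. indicator {i} (r k \<omega>) *\<^sub>R h (x k \<omega>) (w k \<omega>) \<partial>M))"
proof -
  let ?C = "{\<omega> \<in> space M. r (Suc k) \<omega> = j}"
  let ?E = "\<lambda>s. \<integral>\<omega>. h (path_state s k \<omega>) (w k \<omega>) \<partial>M"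
  have "{\<omega> \<in> space modes. r (Suc k) \<omega> = j} \<in> sets modes"
    by measurable
  then have C: "?C \<in> sets modes" by simp
  have "has_bochner_integral M (\<lambda>\<omega>. indicator {i} (r k \<omega>) *\<^sub>R h (x k \<omega>) (w k \<omega>))
      (\<Sum>s\<in>paths_to k i. prob (path_event k s) *\<^sub>R ?E s)"
    using k by (rule mode_integral_paths[where h = h]) (rule meas int)+
  then have "p i j *\<^sub>R (\<integral>\<omega>. indicator {i} (r k \<omega>) *\<^sub>R h (x k \<omega>) (w k \<omega>) \<partial>M)
      = p i j *\<^sub>R (\<Sum>s\<in>paths_to k i. prob (path_event k s) *\<^sub>R ?E s)"
    by (simp only: has_bochner_integral_integral_eq)
  also have "\<dots> = (\<Sum>s\<in>paths_to k i. prob (path_event k s \<inter> ?C) *\<^sub>R ?E s)"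
    unfolding scaleR_sum_right path_extend[OF j]
    by (intro sum.cong) (auto simp: paths_to_def)
  finally have eq: "p i j *\<^sub>R (\<integral>\<omega>. indicator {i} (r k \<omega>) *\<^sub>R h (x k \<omega>) (w k \<omega>) \<partial>M)
      = (\<Sum>s\<in>paths_to k i. prob (path_event k s \<inter> ?C) *\<^sub>R ?E s)" .
  have "has_bochner_integral M
      (\<lambda>\<omega>. indicator ?C \<omega> *\<^sub>R indicator {i} (r k \<omega>) *\<^sub>R h (x k \<omega>) (w k \<omega>))
      (\<Sum>s\<in>paths_to k i. prob (path_event k s \<inter> ?C) *\<^sub>R ?E s)"
    using k C by (rule mode_event_integral[where h = h]) (rule meas int)+
  then show ?thesis
    unfolding eq
    by (rule has_bochner_integral_cong[THEN iffD1, rotated -1]) (auto simp: indicator_def)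
qed

section \<open>Moments of the state and the noise on a mode\<close>

definition mode_second_moment :: "nat \<Rightarrow> 's \<Rightarrow> real ^ 'nx ^ 'nx" where
  "mode_second_moment k i = (\<integral>\<omega>. indicator {i} (r k \<omega>) *\<^sub>R outer (x k \<omega>) (x k \<omega>) \<partial>M)"

lemma mode_indicator:
  assumes "k \<le> T"
  shows "has_bochner_integral M (\<lambda>\<omega>. indicator {i} (r k \<omega>)) (mode_prob M r k i)"
    and "mode_prob M r k i = (\<Sum>s\<in>paths_to k i. prob (path_event k s))"
proof -
  have "has_bochner_integral M (\<lambda>\<omega>. indicator {i} (r k \<omega>) *\<^sub>R (1 :: real))
      (\<Sum>s\<in>paths_to k i. prob (path_event k s) *\<^sub>R (\<integral>\<omega>. 1 \<partial>M))"
    using assms by (rule mode_integral_paths[where h = "\<lambda>_ _. 1"]) auto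
  then have *: "has_bochner_integral M (\<lambda>\<omega>. indicator {i} (r k \<omega>))
      (\<Sum>s\<in>paths_to k i. prob (path_event k s))"
    by (simp add: prob_space)
  then show eq: "mode_prob M r k i = (\<Sum>s\<in>paths_to k i. prob (path_event k s))"
    unfolding mode_prob_def by (rule has_bochner_integral_integral_eq)
  show "has_bochner_integral M (\<lambda>\<omega>. indicator {i} (r k \<omega>)) (mode_prob M r k i)"
    unfolding eq by (rule *)
qed

text \<open>For quantities whose mean does not depend on the path, the mean is also that on each mode. This
  applies to the moments of the noise and to its correlation with the state.\<close>

lemma mode_integral_const:
  fixes h :: "real ^ 'nx \<Rightarrow> real ^ 'nw \<Rightarrow> 'b::euclidean_space"
  assumes k: "k \<le> T"
    and meas: "\<And>s. (\<lambda>\<omega>. h (path_state s k \<omega>) (w k \<omega>)) \<in> borel_measurable driver"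
    and int: "\<And>s. integrable M (\<lambda>\<omega>. h (path_state s k \<omega>) (w k \<omega>))"
    and mean: "\<And>s. (\<integral>\<omega>. h (path_state s k \<omega>) (w k \<omega>) \<partial>M) = v"
  shows "has_bochner_integral M (\<lambda>\<omega>. indicator {i} (r k \<omega>) *\<^sub>R h (x k \<omega>) (w k \<omega>))
    (mode_prob M r k i *\<^sub>R v)"
proof -
  have "has_bochner_integral M (\<lambda>\<omega>. indicator {i} (r k \<omega>) *\<^sub>R h (x k \<omega>) (w k \<omega>))
      (\<Sum>s\<in>paths_to k i. prob (path_event k s) *\<^sub>R (\<integral>\<omega>. h (path_state s k \<omega>) (w k \<omega>) \<partial>M))"
    using k by (rule mode_integral_paths[where h = h]) (rule meas int)+
  then show ?thesis
    by (simp add: mean mode_indicator(2)[OF k] scaleR_sum_left)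
qed

lemma mode_state:
  assumes "k \<le> T"
  shows "has_bochner_integral M (\<lambda>\<omega>. indicator {i} (r k \<omega>) *\<^sub>R x k \<omega>) (mode_moment M r x k i)"
proof -
  have "has_bochner_integral M (\<lambda>\<omega>. indicator {i} (r k \<omega>) *\<^sub>R x k \<omega>)
     (\<Sum>s\<in>paths_to k i. prob (path_event k s) *\<^sub>R (\<integral>\<omega>. path_state s k \<omega> \<partial>M))"
    by (rule mode_integral_paths[where h = "\<lambda>a _. a"])
      (simp_all add: assms square_integrable_imp_integrable path_state_square_integrable)
  then show ?thesis
    unfolding mode_moment_def by (simp add: has_bochner_integral_iff)
qed

lemma mode_state_state:
  assumes "k \<le> T"
  shows "has_bochner_integral M (\<lambda>\<omega>. indicator {i} (r k \<omega>) *\<^sub>R outer (x k \<omega>) (x k \<omega>))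
    (mode_second_moment k i)"
proof -
  have "has_bochner_integral M (\<lambda>\<omega>. indicator {i} (r k \<omega>) *\<^sub>R outer (x k \<omega>) (x k \<omega>))
     (\<Sum>s\<in>paths_to k i. prob (path_event k s) *\<^sub>R
        (\<integral>\<omega>. outer (path_state s k \<omega>) (path_state s k \<omega>) \<partial>M))"
    by (rule mode_integral_paths[where h = "\<lambda>a _. outer a a"])
      (simp_all add: assms square_integrable_imp_integrable_outer path_state_square_integrable)
  then show ?thesis
    unfolding mode_second_moment_def by (simp add: has_bochner_integral_iff)
qed

lemma mode_noise:
  assumes "k \<le> T"
  shows "has_bochner_integral M (\<lambda>\<omega>. indicator {i} (r k \<omega>) *\<^sub>R w k \<omega>) 0"
proof -
  have "has_bochner_integral M (\<lambda>\<omega>. indicator {i} (r k \<omega>) *\<^sub>R w k \<omega>) (mode_prob M r k i *\<^sub>R 0)"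
    by (rule mode_integral_const[where h = "\<lambda>_ b. b"])
      (simp_all add: assms noise_mean square_integrable_imp_integrable noise_square_integrable)
  then show ?thesis by simp
qed

lemma mode_noise_noise:
  assumes "k \<le> T"
  shows "has_bochner_integral M (\<lambda>\<omega>. indicator {i} (r k \<omega>) *\<^sub>R outer (w k \<omega>) (w k \<omega>))
    (mode_prob M r k i *\<^sub>R mat 1)"
  by (rule mode_integral_const[where h = "\<lambda>_ b. outer b b"])
    (simp_all add: assms noise_cov square_integrable_imp_integrable_outer noise_square_integrable)

lemma mode_state_noise:
  assumes "k \<le> T"
  shows "has_bochner_integral M (\<lambda>\<omega>. indicator {i} (r k \<omega>) *\<^sub>R outer (x k \<omega>) (w k \<omega>)) 0"
proof -
  have "has_bochner_integral M (\<lambda>\<omega>. indicator {i} (r k \<omega>) *\<^sub>R outer (x k \<omega>) (w k \<omega>))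
      (mode_prob M r k i *\<^sub>R 0)"
    by (rule mode_integral_const[where h = outer])
      (simp_all add: assms path_state_noise_uncorrelated square_integrable_imp_integrable_outer
        noise_square_integrable path_state_square_integrable)
  then show ?thesis by simp
qed

lemma mode_noise_state:
  assumes "k \<le> T"
  shows "has_bochner_integral M (\<lambda>\<omega>. indicator {i} (r k \<omega>) *\<^sub>R outer (w k \<omega>) (x k \<omega>)) 0"
  using has_bochner_integral_bounded_linear[OF bounded_linear_transpose mode_state_noise[OF assms, of i]]
  by (simp add: linear_simps[OF bounded_linear_transpose] transpose_outer)

lemma affine_mean:
  assumes k: "k \<le> T"
  shows "(\<integral>\<omega>. indicator {i} (r k \<omega>) *\<^sub>R (D *v x k \<omega> + b + H *v w k \<omega>) \<partial>M)
    = D *v mode_moment M r x k i + mode_prob M r k i *\<^sub>R b"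
proof -
  have "has_bochner_integral M
      (\<lambda>\<omega>. D *v (indicator {i} (r k \<omega>) *\<^sub>R x k \<omega>) + indicator {i} (r k \<omega>) *\<^sub>R b
        + H *v (indicator {i} (r k \<omega>) *\<^sub>R w k \<omega>))
      (D *v mode_moment M r x k i + mode_prob M r k i *\<^sub>R b + H *v 0)"
    by (intro has_bochner_integral_add has_bochner_integral_scaleR_left
        has_bochner_integral_bounded_linear[OF matrix_vector_mul_bounded_linear]
        mode_state mode_noise mode_indicator k)
  from has_bochner_integral_integral_eq[OF this] show ?thesis
    by (simp add: matrix_vector_mult_scaleR scaleR_add_right)
qed

lemma affine_second_moment:
  fixes D :: "real ^ 'nx ^ 'm" and b :: "real ^ 'm" and H :: "real ^ 'nw ^ 'm"
  assumes k: "k \<le> T"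
  shows "(\<integral>\<omega>. indicator {i} (r k \<omega>) *\<^sub>R
        outer (D *v x k \<omega> + b + H *v w k \<omega>) (D *v x k \<omega> + b + H *v w k \<omega>) \<partial>M)
    = D ** mode_second_moment k i ** transpose D
      + outer (D *v mode_moment M r x k i) b + outer b (D *v mode_moment M r x k i)
      + mode_prob M r k i *\<^sub>R (outer b b + H ** transpose H)"
proof -
  let ?I = "\<lambda>\<omega>. indicator {i} (r k \<omega>) :: real"
  note L = has_bochner_integral_bounded_linear[OF bounded_linear_matrix_left]
  note R = has_bochner_integral_bounded_linear[OF bounded_linear_matrix_right]
  note V = has_bochner_integral_bounded_linear[OF matrix_vector_mul_bounded_linear]
  note O1 = has_bochner_integral_bounded_linear[OF bounded_bilinear.bounded_linear_left[OF bounded_bilinear_outer]]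
  note O2 = has_bochner_integral_bounded_linear[OF bounded_bilinear.bounded_linear_right[OF bounded_bilinear_outer]]
  have "has_bochner_integral M
      (\<lambda>\<omega>. D ** (?I \<omega> *\<^sub>R outer (x k \<omega>) (x k \<omega>)) ** transpose D
        + D ** (?I \<omega> *\<^sub>R outer (x k \<omega>) (w k \<omega>)) ** transpose H
        + H ** (?I \<omega> *\<^sub>R outer (w k \<omega>) (x k \<omega>)) ** transpose D
        + H ** (?I \<omega> *\<^sub>R outer (w k \<omega>) (w k \<omega>)) ** transpose H
        + outer (D *v (?I \<omega> *\<^sub>R x k \<omega>)) b + outer b (D *v (?I \<omega> *\<^sub>R x k \<omega>))
        + outer (H *v (?I \<omega> *\<^sub>R w k \<omega>)) b + outer b (H *v (?I \<omega> *\<^sub>R w k \<omega>))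
        + ?I \<omega> *\<^sub>R outer b b)
      (D ** mode_second_moment k i ** transpose D + D ** 0 ** transpose H + H ** 0 ** transpose D
        + H ** (mode_prob M r k i *\<^sub>R mat 1) ** transpose H
        + outer (D *v mode_moment M r x k i) b + outer b (D *v mode_moment M r x k i)
        + outer (H *v 0) b + outer b (H *v 0) + mode_prob M r k i *\<^sub>R outer b b)"
    by (intro has_bochner_integral_add has_bochner_integral_scaleR_left L R V O1 O2
        mode_state mode_noise mode_indicator mode_state_state mode_state_noise mode_noise_state
        mode_noise_noise k)
  moreover have "?I \<omega> *\<^sub>R outer (D *v x k \<omega> + b + H *v w k \<omega>) (D *v x k \<omega> + b + H *v w k \<omega>)
      = D ** (?I \<omega> *\<^sub>R outer (x k \<omega>) (x k \<omega>)) ** transpose D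
        + D ** (?I \<omega> *\<^sub>R outer (x k \<omega>) (w k \<omega>)) ** transpose H
        + H ** (?I \<omega> *\<^sub>R outer (w k \<omega>) (x k \<omega>)) ** transpose D
        + H ** (?I \<omega> *\<^sub>R outer (w k \<omega>) (w k \<omega>)) ** transpose H
        + outer (D *v (?I \<omega> *\<^sub>R x k \<omega>)) b + outer b (D *v (?I \<omega> *\<^sub>R x k \<omega>))
        + outer (H *v (?I \<omega> *\<^sub>R w k \<omega>)) b + outer b (H *v (?I \<omega> *\<^sub>R w k \<omega>))
        + ?I \<omega> *\<^sub>R outer b b" for \<omega>
    by (simp add: outer_simps matrix_vector_mult_scaleR linear_simps[OF bounded_linear_matrix_left]
        linear_simps[OF bounded_linear_matrix_right] outer_matrix_left outer_matrix_right
        matrix_mul_assoc scaleR_add_right add_ac)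
  ultimately show ?thesis
    by (simp add: has_bochner_integral_iff outer_simps linear_simps[OF bounded_linear_matrix_left]
        linear_simps[OF bounded_linear_matrix_right] scaleR_add_right add_ac)
qed

section \<open>Recursions for the moments\<close>

lemma next_mode_integral:
  fixes f :: "real ^ 'nx \<Rightarrow> 'b::euclidean_space"
  assumes k: "k < T" and j: "j \<in> S"
    and meas: "\<And>s. (\<lambda>\<omega>. f (path_state s (Suc k) \<omega>)) \<in> borel_measurable driver"
    and int: "\<And>s. integrable M (\<lambda>\<omega>. f (path_state s (Suc k) \<omega>))"
  shows "(\<integral>\<omega>. indicator {j} (r (Suc k) \<omega>) *\<^sub>R f (x (Suc k) \<omega>) \<partial>M)
    = (\<Sum>i\<in>S. p i j *\<^sub>R (\<integral>\<omega>. indicator {i} (r k \<omega>) *\<^sub>R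
        f (F k i *v x k \<omega> + d k i + G k i *v w k \<omega>) \<partial>M))"
proof -
  let ?h = "\<lambda>i a b. f (F k i *v a + d k i + G k i *v b)"
  have step: "has_bochner_integral M
      (\<lambda>\<omega>. indicator {j} (r (Suc k) \<omega>) *\<^sub>R indicator {i} (r k \<omega>) *\<^sub>R ?h i (x k \<omega>) (w k \<omega>))
      (p i j *\<^sub>R (\<integral>\<omega>. indicator {i} (r k \<omega>) *\<^sub>R ?h i (x k \<omega>) (w k \<omega>) \<partial>M))" for i
  proof (rule markov_step[where h = "?h i"])
    \<comment> \<open>One step in mode \<open>i\<close> after the path \<open>s\<close> is a path state again, because a path state at
      time \<open>k\<close> does not depend on \<open>s k\<close>.\<close>
    have eq: "(\<lambda>\<omega>. ?h i (path_state s k \<omega>) (w k \<omega>)) = (\<lambda>\<omega>. f (path_state (s(k := i)) (Suc k) \<omega>))"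
      for s
    proof -
      have "path_state (s(k := i)) l \<omega> = path_state s l \<omega>" if "l \<le> k" for l \<omega>
        using that by (induction l) auto
      then show ?thesis by simp
    qed
    show "(\<lambda>\<omega>. ?h i (path_state s k \<omega>) (w k \<omega>)) \<in> borel_measurable driver"
      and "integrable M (\<lambda>\<omega>. ?h i (path_state s k \<omega>) (w k \<omega>))" for s
      unfolding eq by (rule meas int)+
  qed (use k j in auto)
  have "(\<integral>\<omega>. indicator {j} (r (Suc k) \<omega>) *\<^sub>R f (x (Suc k) \<omega>) \<partial>M)
      = (\<integral>\<omega>. (\<Sum>i\<in>S. indicator {j} (r (Suc k) \<omega>) *\<^sub>R indicator {i} (r k \<omega>) *\<^sub>R
          ?h i (x k \<omega>) (w k \<omega>)) \<partial>M)"
  proof (rule Bochner_Integration.integral_cong)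
    fix \<omega> assume \<omega>: "\<omega> \<in> space M"
    have "(\<Sum>i\<in>S. indicator {j} (r (Suc k) \<omega>) *\<^sub>R indicator {i} (r k \<omega>) *\<^sub>R ?h i (x k \<omega>) (w k \<omega>))
        = (\<Sum>i\<in>S. if r k \<omega> = i then indicator {j} (r (Suc k) \<omega>) *\<^sub>R ?h i (x k \<omega>) (w k \<omega>) else 0)"
      by (intro sum.cong) (auto simp: indicator_def)
    then show "indicator {j} (r (Suc k) \<omega>) *\<^sub>R f (x (Suc k) \<omega>)
        = (\<Sum>i\<in>S. indicator {j} (r (Suc k) \<omega>) *\<^sub>R indicator {i} (r k \<omega>) *\<^sub>R ?h i (x k \<omega>) (w k \<omega>))"
      using mode_in[OF \<omega>] by (simp add: finite_modes dynamics[OF k \<omega>])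
  qed simp
  also have "\<dots> = (\<Sum>i\<in>S. p i j *\<^sub>R (\<integral>\<omega>. indicator {i} (r k \<omega>) *\<^sub>R ?h i (x k \<omega>) (w k \<omega>) \<partial>M))"
    by (rule has_bochner_integral_integral_eq[OF has_bochner_integral_sum[OF step]])
  finally show ?thesis .
qed

theorem mode_moment_Suc:
  assumes k: "k < T" and j: "j \<in> S"
  shows "mode_moment M r x (Suc k) j
    = (\<Sum>i\<in>S. p i j *\<^sub>R (F k i *v mode_moment M r x k i + mode_prob M r k i *\<^sub>R d k i))"
  unfolding mode_moment_def[of M r x "Suc k" j]
  using next_mode_integral[where f = "\<lambda>a. a", OF k j] k
  by (simp add: affine_mean square_integrable_imp_integrable path_state_square_integrable
      del: path_state.simps)

theorem mode_second_moment_Suc: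
  assumes k: "k < T" and j: "j \<in> S"
  shows "mode_second_moment (Suc k) j
    = (\<Sum>i\<in>S. p i j *\<^sub>R
        (F k i ** mode_second_moment k i ** transpose (F k i)
          + outer (F k i *v mode_moment M r x k i) (d k i)
          + outer (d k i) (F k i *v mode_moment M r x k i)
          + mode_prob M r k i *\<^sub>R (outer (d k i) (d k i) + G k i ** transpose (G k i))))"
  unfolding mode_second_moment_def[of "Suc k" j]
  using next_mode_integral[where f = "\<lambda>a. outer a a", OF k j] k
  by (simp add: affine_second_moment square_integrable_imp_integrable_outer
      path_state_square_integrable del: path_state.simps)

lemma mode_second_moment_eq_cov:
  assumes k: "k \<le> T" and pos: "mode_prob M r k i \<noteq> 0"
  shows "mode_second_moment k i = mode_cov M r x k i
    + mode_prob M r k i *\<^sub>R outer (mode_mean M r x k i) (mode_mean M r x k i)"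
proof -
  let ?I = "\<lambda>\<omega>. indicator {i} (r k \<omega>) :: real" and ?m = "mode_mean M r x k i"
  note O1 = has_bochner_integral_bounded_linear[OF bounded_bilinear.bounded_linear_left[OF bounded_bilinear_outer]]
  note O2 = has_bochner_integral_bounded_linear[OF bounded_bilinear.bounded_linear_right[OF bounded_bilinear_outer]]
  have m: "mode_moment M r x k i = mode_prob M r k i *\<^sub>R ?m"
    using pos by (simp add: mode_mean_def)
  have "has_bochner_integral M
      (\<lambda>\<omega>. ?I \<omega> *\<^sub>R outer (x k \<omega>) (x k \<omega>) - outer (?I \<omega> *\<^sub>R x k \<omega>) ?m
        - outer ?m (?I \<omega> *\<^sub>R x k \<omega>) + ?I \<omega> *\<^sub>R outer ?m ?m)
      (mode_second_moment k i - outer (mode_moment M r x k i) ?m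
        - outer ?m (mode_moment M r x k i) + mode_prob M r k i *\<^sub>R outer ?m ?m)"
    by (intro has_bochner_integral_add has_bochner_integral_diff has_bochner_integral_scaleR_left
        O1 O2 mode_state mode_indicator mode_state_state k)
  moreover have "?I \<omega> *\<^sub>R outer (x k \<omega>) (x k \<omega>) - outer (?I \<omega> *\<^sub>R x k \<omega>) ?m
        - outer ?m (?I \<omega> *\<^sub>R x k \<omega>) + ?I \<omega> *\<^sub>R outer ?m ?m
      = ?I \<omega> *\<^sub>R outer (x k \<omega> - ?m) (x k \<omega> - ?m)" for \<omega>
    by (simp add: outer_simps scaleR_diff_right)
  moreover have "mode_second_moment k i - outer (mode_moment M r x k i) ?m
        - outer ?m (mode_moment M r x k i) + mode_prob M r k i *\<^sub>R outer ?m ?m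
      = mode_second_moment k i - mode_prob M r k i *\<^sub>R outer ?m ?m"
    unfolding m by (simp add: outer_simps)
  ultimately have "has_bochner_integral M (\<lambda>\<omega>. ?I \<omega> *\<^sub>R outer (x k \<omega> - ?m) (x k \<omega> - ?m))
      (mode_second_moment k i - mode_prob M r k i *\<^sub>R outer ?m ?m)"
    by simp
  then show ?thesis
    by (simp add: mode_cov_def has_bochner_integral_iff)
qed

end


section \<open>Mean and covariance under mode-dependent affine feedback\<close>

theorem mainTheorem3:
  fixes M :: "'a measure"
    and N T :: nat
    and p :: "nat \<Rightarrow> nat \<Rightarrow> real"
    and rho0 :: "nat \<Rightarrow> real"
    and r :: "nat \<Rightarrow> 'a \<Rightarrow> nat"
    and x :: "nat \<Rightarrow> 'a \<Rightarrow> real ^ 'nx"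
    and u :: "nat \<Rightarrow> 'a \<Rightarrow> real ^ 'nu"
    and w :: "nat \<Rightarrow> 'a \<Rightarrow> real ^ 'nw"
    and A :: "nat \<Rightarrow> nat \<Rightarrow> real ^ 'nx ^ 'nx"
    and B :: "nat \<Rightarrow> nat \<Rightarrow> real ^ 'nu ^ 'nx"
    and G :: "nat \<Rightarrow> nat \<Rightarrow> real ^ 'nw ^ 'nx"
    and c :: "nat \<Rightarrow> nat \<Rightarrow> real ^ 'nx"
    and ubar :: "nat \<Rightarrow> nat \<Rightarrow> real ^ 'nu"
    and K :: "nat \<Rightarrow> nat \<Rightarrow> real ^ 'nx ^ 'nu"
    and rho :: "nat \<Rightarrow> nat \<Rightarrow> real"
    and q xbar :: "nat \<Rightarrow> nat \<Rightarrow> real ^ 'nx"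
    and S :: "nat \<Rightarrow> nat \<Rightarrow> real ^ 'nx ^ 'nx"
  assumes prob: "prob_space M"
    and chain: "markov_chain M {1..N} p rho0 r"
    and noise: "white_noise M w"
    and x0_measurable: "x 0 \<in> borel_measurable M"
    and x0_moment: "integrable M (\<lambda>\<omega>. (norm (x 0 \<omega>))\<^sup>2)"
    and indep: "indep_init_noise_mode M (x 0) w r"
    and rho: "rho = mode_prob M r"
    and q: "q = mode_moment M r x"
    and xbar: "xbar = mode_mean M r x"
    and S: "S = mode_cov M r x"
    and policy: "\<And>k \<omega>. k < T \<Longrightarrow> \<omega> \<in> space M \<Longrightarrow>
      u k \<omega> = ubar k (r k \<omega>) + K k (r k \<omega>) *v (x k \<omega> - xbar k (r k \<omega>))"
    and dynamics: "\<And>k \<omega>. k < T \<Longrightarrow> \<omega> \<in> space M \<Longrightarrow>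
      x (k + 1) \<omega> = A k (r k \<omega>) *v x k \<omega> + B k (r k \<omega>) *v u k \<omega>
                     + c k (r k \<omega>) + G k (r k \<omega>) *v w k \<omega>"
    and rho_pos: "\<And>k i. k \<le> T \<Longrightarrow> i \<in> {1..N} \<Longrightarrow> 0 < rho k i"
  shows "\<forall>k<T. \<forall>j\<in>{1..N}.
      q (k + 1) j = (\<Sum>i\<in>{1..N}. p i j *\<^sub>R
        (A k i *v q k i + rho k i *\<^sub>R (B k i *v ubar k i + c k i)))
    \<and> S (k + 1) j = (\<Sum>i\<in>{1..N}. p i j *\<^sub>R
        (A k i ** S k i ** transpose (A k i)
         + A k i ** S k i ** transpose (K k i) ** transpose (B k i)
         + B k i ** K k i ** S k i ** transpose (A k i)
         + B k i ** (rho k i *\<^sub>R outer (ubar k i) (ubar k i)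
                     + K k i ** S k i ** transpose (K k i)) ** transpose (B k i)
         + rho k i *\<^sub>R
           (B k i ** outer (ubar k i) (c k i)
            + B k i ** outer (ubar k i) (xbar k i) ** transpose (A k i)
            + outer (c k i) (c k i)
            + A k i ** outer (xbar k i) (ubar k i) ** transpose (B k i)
            + outer (c k i) (ubar k i) ** transpose (B k i)
            + outer (c k i) (xbar k i) ** transpose (A k i)
            + G k i ** transpose (G k i)
            + A k i ** outer (xbar k i) (c k i)
            + A k i ** outer (xbar k i) (xbar k i) ** transpose (A k i))))
      - rho (k + 1) j *\<^sub>R outer (xbar (k + 1) j) (xbar (k + 1) j)"
proof -
  interpret prob_space M by (rule prob)
  let ?F = "\<lambda>k i. A k i + B k i ** K k i"
  let ?d = "\<lambda>k i. B k i *v (ubar k i - K k i *v xbar k i) + c k i"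
  interpret jump_affine_system M "{1..N}" p rho0 r x w ?F ?d G T
  proof
    show "square_integrable M (x 0)"
      using x0_measurable x0_moment by (simp add: square_integrable_def)
    show "x (Suc k) \<omega> = ?F k (r k \<omega>) *v x k \<omega> + ?d k (r k \<omega>) + G k (r k \<omega>) *v w k \<omega>"
      if "k < T" "\<omega> \<in> space M" for k \<omega>
      using dynamics[OF that] policy[OF that]
      by (simp add: matrix_vector_mult_add_rdistrib matrix_vector_right_distrib
          matrix_vector_mult_diff_distrib matrix_vector_mul_assoc)
  qed (fact chain noise indep)+
  have q_eq: "q k i = rho k i *\<^sub>R xbar k i" if "k \<le> T" "i \<in> {1..N}" for k i
    using rho_pos[OF that] by (simp add: q rho xbar mode_mean_def)
  have second: "mode_second_moment k i = S k i + rho k i *\<^sub>R outer (xbar k i) (xbar k i)"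
    if "k \<le> T" "i \<in> {1..N}" for k i
    using mode_second_moment_eq_cov[OF that(1), of i] rho_pos[OF that] by (simp add: S rho xbar)
  show ?thesis
  proof (intro allI impI ballI conjI)
    fix k j assume k: "k < T" and j: "j \<in> {1..N}"
    have "?F k i *v q k i + rho k i *\<^sub>R ?d k i
        = A k i *v q k i + rho k i *\<^sub>R (B k i *v ubar k i + c k i)" if "i \<in> {1..N}" for i
      using k that
      by (simp add: q_eq matrix_vector_mult_add_rdistrib matrix_vector_mult_diff_distrib
          matrix_vector_mul_assoc matrix_vector_mult_scaleR scaleR_add_right scaleR_diff_right)
    then show "q (k + 1) j = (\<Sum>i\<in>{1..N}. p i j *\<^sub>R
        (A k i *v q k i + rho k i *\<^sub>R (B k i *v ubar k i + c k i)))"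
      using mode_moment_Suc[OF k j] by (simp add: q rho)
    have "S (Suc k) j
        = mode_second_moment (Suc k) j - rho (Suc k) j *\<^sub>R outer (xbar (Suc k) j) (xbar (Suc k) j)"
      using second[of "Suc k" j] k j by simp
    also have "mode_second_moment (Suc k) j = (\<Sum>i\<in>{1..N}. p i j *\<^sub>R
        (?F k i ** (S k i + rho k i *\<^sub>R outer (xbar k i) (xbar k i)) ** transpose (?F k i)
          + outer (?F k i *v (rho k i *\<^sub>R xbar k i)) (?d k i)
          + outer (?d k i) (?F k i *v (rho k i *\<^sub>R xbar k i))
          + rho k i *\<^sub>R (outer (?d k i) (?d k i) + G k i ** transpose (G k i))))"
      unfolding mode_second_moment_Suc[OF k j] q[symmetric] rho[symmetric]
      using k by (intro sum.cong refl) (simp add: q_eq second)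
    finally show "S (k + 1) j = (\<Sum>i\<in>{1..N}. p i j *\<^sub>R
        (A k i ** S k i ** transpose (A k i)
         + A k i ** S k i ** transpose (K k i) ** transpose (B k i)
         + B k i ** K k i ** S k i ** transpose (A k i)
         + B k i ** (rho k i *\<^sub>R outer (ubar k i) (ubar k i)
                     + K k i ** S k i ** transpose (K k i)) ** transpose (B k i)
         + rho k i *\<^sub>R
           (B k i ** outer (ubar k i) (c k i)
            + B k i ** outer (ubar k i) (xbar k i) ** transpose (A k i)
            + outer (c k i) (c k i)
            + A k i ** outer (xbar k i) (ubar k i) ** transpose (B k i)
            + outer (c k i) (ubar k i) ** transpose (B k i)
            + outer (c k i) (xbar k i) ** transpose (A k i)
            + G k i ** transpose (G k i)
            + A k i ** outer (xbar k i) (c k i)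
            + A k i ** outer (xbar k i) (xbar k i) ** transpose (A k i))))
      - rho (k + 1) j *\<^sub>R outer (xbar (k + 1) j) (xbar (k + 1) j)"
      unfolding feedback_second_moment by simp
  qed
qed

end
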